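(* Let $\Sigma$ be an alphabet and let $\mathcal R_\Sigma$ be the set of reduced pointed $\Sigma$-labelled finite rooted trees. Then the free $\operatorname{Rel}(;,1,\mathrm{D})$-algebra over $\Sigma$ is $\mathcal R_\Sigma$ equipped with pointed tree concatenation, tree domain, and the constant $\mathbf 1$ (freely generated by the trees $\vec a$, $a\in\Sigma$).
   Context: $\operatorname{Rel}(;,1,\mathrm{D})$ is the class of algebras isomorphic to a set of binary relations on a common base $X$ closed under composition $R;S=\{(x,y):\exists z\,(x,z)\in R,(z,y)\in S\}$, domain $\mathrm{D}(R)=\{(x,x):\exists y\,(x,y)\in R\}$, and containing the identity $1$ on $X$, with these operations. Labelled rooted trees over $\Sigma$: defined recursively as finite sets of pairs $(a,T)$, $a\in\Sigma$ ($\emptyset$ the one-vertex tree), the pair $(a,T)$ representing a child of the root joined by an $a$-labelled edge with subtree $T$; pointed trees have a distinguished vertex (point). Preorder $\leq$: for roots $r_1,r_2$, $T_1\le T_2$ iff (a) if $r_2$ is the point of $T_2$ then $r_1$ is the point of $T_1$, and (b) every child $v_2$ of $r_2$ has a child $v_1$ of $r_1$ with equal edge labels and $T_{v_1}\le T_{v_2}$ ($T_v$ the subtree at $v$, pointed iff it contains the point). Reduced form: recursively reduce child subtrees, then for each label $a$ remove the child subtrees along $a$-edges that are not $\leq$-minimal among them; reduced = equal to its reduced form. Concatenation $T;S$ of reduced pointed trees: identify point of $T$ with root of $S$ (root of $T$ is root, point of $S$ is point), then reduce. Domain $\mathrm{D}(T)$: move point to root, then reduce. $\vec a$: two-vertex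 tree with one $a$-edge, point at the child; $\mathbf 1$: one-vertex pointed tree. *)

theory Defs
  imports "HOL-Library.FSet" "HOL-Algebra.Group"
begin

section \<open>Algebras of the signature (;, 1, D) and the class Rel(;, 1, D)\<close>

record 'b dom_monoid = "'b monoid" +
  Dom :: "'b \<Rightarrow> 'b"

definition dom_closed :: "'b dom_monoid \<Rightarrow> 'b set \<Rightarrow> bool" where
  "dom_closed A S \<longleftrightarrow>
     \<one>\<^bsub>A\<^esub> \<in> S \<and> (\<forall>x\<in>S. \<forall>y\<in>S. x \<otimes>\<^bsub>A\<^esub> y \<in> S) \<and> (\<forall>x\<in>S. Dom A x \<in> S)"

definition dom_hom :: "'b dom_monoid \<Rightarrow> 'c dom_monoid \<Rightarrow> ('b \<Rightarrow> 'c) set" where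
  "dom_hom A B =
     {h. h \<in> hom A B \<and> h \<one>\<^bsub>A\<^esub> = \<one>\<^bsub>B\<^esub> \<and> (\<forall>x\<in>carrier A. h (Dom A x) = Dom B (h x))}"

definition dom_generated :: "'b dom_monoid \<Rightarrow> 'b set \<Rightarrow> 'b set" where
  "dom_generated A G = \<Inter>{S. S \<subseteq> carrier A \<and> G \<subseteq> S \<and> dom_closed A S}"

definition rel_algebra :: "'x set \<Rightarrow> 'x rel set \<Rightarrow> 'x rel dom_monoid" where
  "rel_algebra X R =
     \<lparr>carrier = R, mult = (O), one = Id_on X, Dom = (\<lambda>r. Id_on (Domain r))\<rparr>"

text \<open>
  Membership in Rel(;, 1, D), witnessed by a base set of elements of the type \<open>'x\<close>.
  The type argument is needed because HOL has no existential quantification over types.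
  Closure of the carrier is required explicitly since a bijective homomorphism
  alone does not force it.
\<close>

definition in_Rel :: "'x itself \<Rightarrow> 'b dom_monoid \<Rightarrow> bool" where
  "in_Rel _ A \<longleftrightarrow> dom_closed A (carrier A) \<and>
     (\<exists>(X :: 'x set) R h. (\<forall>r\<in>R. r \<subseteq> X \<times> X) \<and> dom_closed (rel_algebra X R) R \<and>
        h \<in> dom_hom A (rel_algebra X R) \<and> bij_betw h (carrier A) R)"


section \<open>Pointed labelled rooted trees\<close>

text \<open>
  The Boolean at a vertex says whether that vertex is the point. A tree with no mark is
  an unpointed tree; a tree with exactly one mark is a pointed tree.
\<close>

datatype (labels: 'a) ptree = Node (at_root: bool) (children: "('a \<times> 'a ptree) fset")

function points :: "'a ptree \<Rightarrow> nat" where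
  "points (Node p C) = of_bool p + (\<Sum>c\<in>fset C. points (snd c))"
  by pat_completeness auto
termination
proof (relation "measure size")
  fix p :: bool and C :: "('a \<times> 'a ptree) fset" and c
  assume c: "c \<in> fset C"
  let ?g = "map_prod (\<lambda>x. x) (\<lambda>t. (t, size t)) :: 'a \<times> 'a ptree \<Rightarrow> _"
  have "size (snd c) < Suc (size_prod (\<lambda>_. 0) snd (?g c))"
    by (cases c) simp
  also have "\<dots> \<le> (\<Sum>x\<in>?g ` fset C. Suc (size_prod (\<lambda>_. 0) snd x))"
    using c by (intro member_le_sum) auto
  finally show "(snd c, Node p C) \<in> measure size"
    by simp
qed simp

definition pointed :: "'a ptree \<Rightarrow> bool" where
  "pointed t \<longleftrightarrow> points t = 1"

inductive tree_le :: "'a ptree \<Rightarrow> 'a ptree \<Rightarrow> bool" (infix "\<preceq>" 50) where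
  "(p\<^sub>2 \<longrightarrow> p\<^sub>1) \<Longrightarrow> (\<forall>(a, t\<^sub>2)\<in>fset C\<^sub>2. \<exists>t\<^sub>1. (a, t\<^sub>1) |\<in>| C\<^sub>1 \<and> t\<^sub>1 \<preceq> t\<^sub>2)
     \<Longrightarrow> Node p\<^sub>1 C\<^sub>1 \<preceq> Node p\<^sub>2 C\<^sub>2"

definition minimal_children :: "('a \<times> 'a ptree) fset \<Rightarrow> ('a \<times> 'a ptree) fset" where
  "minimal_children C = ffilter (\<lambda>(a, t). \<not> (\<exists>s. (a, s) |\<in>| C \<and> s \<preceq> t \<and> \<not> t \<preceq> s)) C"

primrec reduce :: "'a ptree \<Rightarrow> 'a ptree" where
  "reduce (Node p C) = Node p (minimal_children (map_prod id reduce |`| C))"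

definition reduced :: "'a ptree \<Rightarrow> bool" where
  "reduced t \<longleftrightarrow> reduce t = t"

primrec graft :: "'a ptree \<Rightarrow> 'a ptree \<Rightarrow> 'a ptree" where
  "graft s (Node p C) =
     (if p then Node (at_root s) (C |\<union>| children s)
      else Node False (map_prod id (graft s) |`| C))"

definition tree_concat :: "'a ptree \<Rightarrow> 'a ptree \<Rightarrow> 'a ptree" where
  "tree_concat t s = reduce (graft s t)"

primrec unpoint :: "'a ptree \<Rightarrow> 'a ptree" where
  "unpoint (Node p C) = Node False (map_prod id unpoint |`| C)"

definition tree_dom :: "'a ptree \<Rightarrow> 'a ptree" where
  "tree_dom t = reduce (Node True (children (unpoint t)))"

definition one_tree :: "'a ptree" where
  "one_tree = Node True {||}"

definition edge_tree :: "'a \<Rightarrow> 'a ptree" where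
  "edge_tree a = Node False {|(a, one_tree)|}"

definition reduced_trees :: "'a set \<Rightarrow> 'a ptree set" where
  "reduced_trees \<Sigma> = {t. labels t \<subseteq> \<Sigma> \<and> pointed t \<and> reduced t}"

definition tree_algebra :: "'a set \<Rightarrow> 'a ptree dom_monoid" where
  "tree_algebra \<Sigma> =
     \<lparr>carrier = reduced_trees \<Sigma>, mult = tree_concat, one = one_tree, Dom = tree_dom\<rparr>"

end

theory Submission
  imports Defs
begin

text \<open>
  A pointed tree \<open>t\<close> denotes, in any \<open>\<Sigma>\<close>-labelled graph, the relation of all pairs
  \<open>(x, y)\<close> such that some homomorphism from \<open>t\<close> to the graph sends the root to \<open>x\<close>
  and the point to \<open>y\<close>. This denotation is invariant under reduction and turns concatenation and
  tree domain into composition and domain of relations. Together with generation by the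
  edge trees, it yields the universal property.

  For the representation, take the graph whose vertices are all trees and whose \<open>a\<close>-edges lead
  from a tree to its \<open>a\<close>-children. If \<open>y\<close> is the subtree at the point of \<open>t\<close>, then
  \<open>(t, y)\<close> lies in the denotation of \<open>s\<close> iff \<open>t \<preceq> s\<close>. As \<open>\<preceq>\<close> is antisymmetric on
  reduced trees, the denotation in this graph is faithful; the compatibility of reduction with
  the operations on trees follows from the faithfulness as well.
\<close>

section \<open>Induction principles for trees and for pointed trees\<close>

lemma ptree_induct [case_names Node]:
  assumes "\<And>p C. (\<And>a c. (a, c) |\<in>| C \<Longrightarrow> P c) \<Longrightarrow> P (Node p C)"
  shows "P t"
proof (induction t)
  case (Node p C)
  show ?case
    by (rule assms) (use Node in force)
qed

lemma points_Node_eq_0: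
  "points (Node p C) = 0 \<longleftrightarrow> \<not> p \<and> (\<forall>a c. (a, c) |\<in>| C \<longrightarrow> points c = 0)"
  by fastforce

lemma points_Node_True:
  "points (Node True C) = 1 \<longleftrightarrow> (\<forall>a c. (a, c) |\<in>| C \<longrightarrow> points c = 0)"
  by fastforce

lemma points_Node_finsert:
  assumes "points c = 1" "\<forall>b d. (b, d) |\<in>| C \<longrightarrow> points d = 0"
  shows "points (Node False (finsert (a, c) C)) = 1"
proof -
  \<comment> \<open>The sum in \<open>points\<close> runs over a set, so a summand is added only if
    the pair is new. It is: \<open>c\<close> contains a mark, the children in \<open>C\<close> do
    not.\<close>
  have "(a, c) |\<notin>| C"
    using assms by auto
  moreover have "(\<Sum>d\<in>fset C. points (snd d)) = 0"
    using assms(2) by fastforce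
  ultimately show ?thesis
    using assms(1) by simp
qed

text \<open>Induction along the path from the root to the point: a single mark sits either at the
  root or in exactly one child subtree. The siblings \<open>C\<close> are unmarked and are left to
  the facts about unmarked trees.\<close>

lemma pointed_induct [consumes 1, case_names root below]:
  assumes "points t = 1"
    and root: "\<And>C. (\<forall>b d. (b, d) |\<in>| C \<longrightarrow> points d = 0) \<Longrightarrow> P (Node True C)"
    and below: "\<And>a c C. points c = 1 \<Longrightarrow> P c \<Longrightarrow> (\<forall>b d. (b, d) |\<in>| C \<longrightarrow> points d = 0)
      \<Longrightarrow> P (Node False (finsert (a, c) C))"
  shows "P t"
  using assms(1)
proof (induction t rule: ptree_induct)
  case (Node p C)
  show ?case
  proof (cases p)
    case True
    then show ?thesis
      using Node.prems root by (simp only: points_Node_True)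
  next
    case False
    then have 1: "(\<Sum>d\<in>fset C. points (snd d)) = 1"
      using Node.prems by simp
    then obtain e where e: "e \<in> fset C" "points (snd e) = 1" "\<forall>d\<in>fset C. d \<noteq> e \<longrightarrow> points (snd d) = 0"
      by (subst (asm) sum_eq_1_iff) auto
    obtain a c where [simp]: "e = (a, c)"
      by fastforce
    have "P (Node False (finsert (a, c) (C |-| {|(a, c)|})))"
      using e by (intro below Node.IH[of a]) auto
    moreover have "finsert (a, c) (C |-| {|(a, c)|}) = C"
      using e by auto
    ultimately show ?thesis
      using False by simp
  qed
qed

section \<open>The preorder and reduction\<close>

lemma tree_le_Node:
  "Node p C \<preceq> Node q D \<longleftrightarrow>
    (q \<longrightarrow> p) \<and> (\<forall>b d. (b, d) |\<in>| D \<longrightarrow> (\<exists>c. (b, c) |\<in>| C \<and> c \<preceq> d))"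
  by (subst tree_le.simps) auto

lemma tree_le_refl: "t \<preceq> t"
  by (induction t rule: ptree_induct) (auto simp: tree_le_Node)

lemma tree_le_trans: "s \<preceq> t \<Longrightarrow> t \<preceq> u \<Longrightarrow> s \<preceq> u"
proof (induction u arbitrary: s t rule: ptree_induct)
  case (Node p C)
  obtain q D r F where st: "s = Node q D" "t = Node r F"
    by (cases s, cases t) blast
  show ?case
    using Node unfolding st tree_le_Node by meson
qed

text \<open>\<open>s \<preceq> t\<close> amounts to a map from \<open>t\<close> to \<open>s\<close>
  that preserves the root, labelled edges and marks, so a mark in \<open>t\<close> forces one in
  \<open>s\<close>.\<close>

lemma tree_le_points_0: "s \<preceq> t \<Longrightarrow> points s = 0 \<Longrightarrow> points t = 0"
proof (induction t arbitrary: s rule: ptree_induct)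
  case (Node p C)
  then show ?case
    by (cases s) (metis tree_le_Node points_Node_eq_0)
qed

lemma minimal_children_iff:
  "(a, c) |\<in>| minimal_children C \<longleftrightarrow>
    (a, c) |\<in>| C \<and> (\<forall>s. (a, s) |\<in>| C \<longrightarrow> s \<preceq> c \<longrightarrow> c \<preceq> s)"
  by (auto simp: minimal_children_def)

lemma minimal_children_empty: "minimal_children {||} = {||}"
  by (rule fset_eqI) (simp add: minimal_children_def)

lemma minimal_children_singleton: "minimal_children {|e|} = {|e|}"
  by (rule fset_eqI, cases e) (auto simp: minimal_children_iff tree_le_refl)

lemma minimal_child_below:
  assumes "(a, c) |\<in>| C"
  obtains m where "(a, m) |\<in>| minimal_children C" "m \<preceq> c"
proof -
  define below where "below t = {s. (a, s) |\<in>| C \<and> s \<preceq> t}" for t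
  have fin: "finite (below t)" for t
  proof (rule finite_subset)
    show "below t \<subseteq> snd ` fset C"
      unfolding below_def by force
  qed simp
  have c: "c \<in> below c"
    using assms by (simp add: below_def tree_le_refl)
  \<comment> \<open>Since \<open>\<preceq>\<close> is only a preorder, a minimal element is found by
    counting: \<open>m\<close> has the fewest \<open>a\<close>-children below it.\<close>
  obtain m where m: "m \<in> below c" and least: "\<And>s. s \<in> below c \<Longrightarrow> card (below m) \<le> card (below s)"
    using ex_has_least_nat[of "\<lambda>t. t \<in> below c" c "\<lambda>t. card (below t)"] c by auto
  have "m \<preceq> s" if s: "(a, s) |\<in>| C" "s \<preceq> m" for s
  proof (rule ccontr)
    assume "\<not> m \<preceq> s"
    then have "m \<in> below m" "m \<notin> below s"
      using m by (simp_all add: below_def tree_le_refl)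
    moreover have "below s \<subseteq> below m"
      unfolding below_def using s(2) tree_le_trans by blast
    ultimately have "below s \<subset> below m"
      by blast
    then have "card (below s) < card (below m)"
      using fin psubset_card_mono by blast
    moreover have "s \<in> below c"
      using s m tree_le_trans unfolding below_def by blast
    ultimately show False
      using least[of s] by simp
  qed
  then show ?thesis
    using m by (intro that[of m]) (auto simp: minimal_children_iff below_def)
qed

lemma child_image_iff:
  "(a, c) |\<in>| map_prod id f |`| C \<longleftrightarrow> (\<exists>d. (a, d) |\<in>| C \<and> c = f d)"
  "(a, c) \<in> map_prod id f ` fset C \<longleftrightarrow> (\<exists>d. (a, d) |\<in>| C \<and> c = f d)"
  by force+

text \<open>Every discarded child has a minimal one below it, which gives the first claim; for the
  second, every child kept is the reduced form of an original child.\<close>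

lemma reduce_tree_le: "reduce t \<preceq> t" and tree_le_reduce: "t \<preceq> reduce t"
proof (induction t rule: ptree_induct)
  case (Node p C)
  {
    case 1
    show ?case
      unfolding reduce.simps tree_le_Node
    proof (intro conjI allI impI)
      fix b d
      assume d: "(b, d) |\<in>| C"
      then have "(b, reduce d) |\<in>| map_prod id reduce |`| C"
        by (auto simp: child_image_iff)
      then obtain m where "(b, m) |\<in>| minimal_children (map_prod id reduce |`| C)" "m \<preceq> reduce d"
        by (rule minimal_child_below)
      then show "\<exists>c. (b, c) |\<in>| minimal_children (map_prod id reduce |`| C) \<and> c \<preceq> d"
        using Node(1)[OF d] tree_le_trans by blast
    qed
  next
    case 2
    show ?case
      using Node(2) by (auto simp: tree_le_Node minimal_children_iff child_image_iff)
  }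
qed

text \<open>A zigzag: a kept child \<open>c\<close> has a \<open>d\<close> below it on the other
  side, and \<open>d\<close> has a \<open>c'\<close> below it on the first side. Minimality of
  \<open>c\<close> gives \<open>c \<preceq> c'\<close>, so \<open>c\<close> and \<open>d\<close> lie
  below each other and are equal by induction.\<close>

lemma reduce_le_antisym: "reduce s \<preceq> reduce t \<Longrightarrow> reduce t \<preceq> reduce s \<Longrightarrow> reduce s = reduce t"
proof (induction s arbitrary: t rule: ptree_induct)
  case (Node p C)
  obtain q D where t: "t = Node q D"
    by (cases t)
  let ?C = "minimal_children (map_prod id reduce |`| C)"
  let ?D = "minimal_children (map_prod id reduce |`| D)"
  have CD: "\<exists>c. (a, c) |\<in>| ?C \<and> c \<preceq> d" if "(a, d) |\<in>| ?D" for a d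
    using Node.prems(1) that unfolding t reduce.simps tree_le_Node by blast
  have DC: "\<exists>d. (a, d) |\<in>| ?D \<and> d \<preceq> c" if "(a, c) |\<in>| ?C" for a c
    using Node.prems(2) that unfolding t reduce.simps tree_le_Node by blast
  have IH: "c = d" if "(a, c) |\<in>| ?C" "(a, d) |\<in>| ?D" "c \<preceq> d" "d \<preceq> c" for a c d
    using that Node.IH by (auto simp: minimal_children_iff child_image_iff)
  have minC: "c \<preceq> s" if "(a, c) |\<in>| ?C" "(a, s) |\<in>| ?C" "s \<preceq> c" for a c s
    using that by (auto simp: minimal_children_iff)
  have minD: "c \<preceq> s" if "(a, c) |\<in>| ?D" "(a, s) |\<in>| ?D" "s \<preceq> c" for a c s
    using that by (auto simp: minimal_children_iff)
  have "e |\<in>| ?D" if "e |\<in>| ?C" for e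
  proof -
    obtain a c where e: "e = (a, c)"
      by fastforce
    with that obtain d where d: "(a, d) |\<in>| ?D" "d \<preceq> c"
      using DC by blast
    then obtain c' where c': "(a, c') |\<in>| ?C" "c' \<preceq> d"
      using CD by blast
    have "c \<preceq> c'"
      using minC[of a c c'] that e c' d tree_le_trans by blast
    then have "c \<preceq> d"
      using c' tree_le_trans by blast
    then show ?thesis
      using IH[of a c d] that e d by blast
  qed
  moreover have "e |\<in>| ?C" if "e |\<in>| ?D" for e
  proof -
    obtain a d where e: "e = (a, d)"
      by fastforce
    with that obtain c where c: "(a, c) |\<in>| ?C" "c \<preceq> d"
      using CD by blast
    then obtain d' where d': "(a, d') |\<in>| ?D" "d' \<preceq> c"
      using DC by blast
    have "d \<preceq> d'"
      using minD[of a d d'] that e c d' tree_le_trans by blast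
    then have "d \<preceq> c"
      using d' tree_le_trans by blast
    then show ?thesis
      using IH[of a c d] that e c by blast
  qed
  ultimately have "?C = ?D"
    by blast
  moreover have "p = q"
    using Node.prems unfolding t by (auto simp: tree_le_Node)
  ultimately show ?case
    by (simp add: t)
qed

lemma reduce_eqI: "s \<preceq> t \<Longrightarrow> t \<preceq> s \<Longrightarrow> reduce s = reduce t"
  by (meson reduce_le_antisym reduce_tree_le tree_le_reduce tree_le_trans)

lemma reduce_reduce: "reduce (reduce t) = reduce t"
  by (rule reduce_eqI[OF reduce_tree_le tree_le_reduce])

lemma points_reduce_0: "points t = 0 \<Longrightarrow> points (reduce t) = 0"
  using tree_le_points_0 tree_le_reduce by blast

text \<open>The child subtree with the mark is never discarded: a subtree below it would also
  contain a mark, and its siblings have none.\<close>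

lemma points_reduce_1: "points t = 1 \<Longrightarrow> points (reduce t) = 1"
proof (induction t rule: pointed_induct)
  case (root C)
  then show ?case
    unfolding reduce.simps points_Node_True
    by (auto simp: minimal_children_iff child_image_iff intro: points_reduce_0)
next
  case (below a c C)
  let ?C = "map_prod id reduce |`| C"
  let ?M = "minimal_children (finsert (a, reduce c) ?C)"
  have 0: "points d = 0" if "(b, d) |\<in>| ?C" for b d
    using that below.hyps(2) by (auto simp: child_image_iff intro: points_reduce_0)
  have "reduce c \<preceq> s" if "(a, s) |\<in>| finsert (a, reduce c) ?C" "s \<preceq> reduce c" for s
  proof -
    have "points s \<noteq> 0"
      using that(2) tree_le_points_0 below.IH by fastforce
    then have "s = reduce c"
      using that(1) 0[of a s] by auto
    then show ?thesis
      by (simp add: tree_le_refl)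
  qed
  then have "(a, reduce c) |\<in>| ?M"
    by (simp add: minimal_children_iff)
  then have M: "finsert (a, reduce c) (?M |-| {|(a, reduce c)|}) = ?M"
    by auto
  have "points (Node False (finsert (a, reduce c) (?M |-| {|(a, reduce c)|}))) = 1"
  proof (rule points_Node_finsert[OF below.IH], intro allI impI)
    fix b d
    assume "(b, d) |\<in>| ?M |-| {|(a, reduce c)|}"
    then show "points d = 0"
      using 0[of b d] by (auto simp: minimal_children_iff simp del: points.simps)
  qed
  then show ?case
    unfolding M by simp
qed

section \<open>Interpretation in labelled graphs\<close>

text \<open>
  Here \<open>sat E t x y\<close> says that there is a homomorphism from \<open>t\<close> to the graph with edge
  relations \<open>E\<close> that sends the root to \<open>x\<close> and every marked vertex to \<open>y\<close>.
\<close>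

inductive sat :: "('a \<Rightarrow> 'x rel) \<Rightarrow> 'a ptree \<Rightarrow> 'x \<Rightarrow> 'x \<Rightarrow> bool" for E where
  "(p \<longrightarrow> x = y) \<Longrightarrow> (\<forall>(a, c)\<in>fset C. \<exists>z. (x, z) \<in> E a \<and> sat E c z y)
     \<Longrightarrow> sat E (Node p C) x y"

lemma sat_Node:
  "sat E (Node p C) x y \<longleftrightarrow>
    (p \<longrightarrow> x = y) \<and> (\<forall>a c. (a, c) |\<in>| C \<longrightarrow> (\<exists>z. (x, z) \<in> E a \<and> sat E c z y))"
  by (subst sat.simps) auto

text \<open>Composition of homomorphisms: the map from \<open>t\<close> to \<open>s\<close> given by
  \<open>s \<preceq> t\<close> is followed by the one from \<open>s\<close> to the graph.\<close>

lemma sat_mono: "s \<preceq> t \<Longrightarrow> sat E s x y \<Longrightarrow> sat E t x y"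
proof (induction t arbitrary: s x rule: ptree_induct)
  case (Node p C)
  then show ?case
    by (cases s) (simp add: tree_le_Node sat_Node, meson)
qed

lemma sat_reduce: "sat E (reduce t) x y \<longleftrightarrow> sat E t x y"
  using sat_mono reduce_tree_le tree_le_reduce by metis

lemma sat_unpointed: "points t = 0 \<Longrightarrow> sat E t x y \<longleftrightarrow> sat E t x z"
proof (induction t arbitrary: x rule: ptree_induct)
  case (Node p C)
  then have "\<not> p" "\<And>a c. (a, c) |\<in>| C \<Longrightarrow> points c = 0"
    unfolding points_Node_eq_0 by auto
  then show ?case
    using Node.IH unfolding sat_Node by blast
qed

lemma sat_below:
  "sat E (Node False (finsert (a, c) C)) x y \<longleftrightarrow>
    (\<exists>z. (x, z) \<in> E a \<and> sat E c z y) \<and> sat E (Node False C) x y"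
  unfolding sat_Node by auto

text \<open>The image \<open>y\<close> of the point is reached from \<open>x\<close> by a path of
  edges, all of which stay inside \<open>X\<close>.\<close>

lemma sat_closed:
  assumes "points t = 1" "\<And>a. E a \<subseteq> X \<times> X" "sat E t x y" "x \<in> X"
  shows "y \<in> X"
  using assms(1,3,4)
proof (induction t arbitrary: x rule: pointed_induct)
  case (root C)
  then show ?case
    by (simp add: sat_Node)
next
  case (below a c C)
  then obtain z where "(x, z) \<in> E a" "sat E c z y"
    unfolding sat_below by blast
  then show ?case
    using below.IH assms(2) by blast
qed

section \<open>Grafting and unpointing, and what they do to homomorphisms\<close>

lemma graft_unpointed: "points t = 0 \<Longrightarrow> graft s t = t"
proof (induction t rule: ptree_induct)
  case (Node p C)
  have "map_prod id (graft s) |`| C = id |`| C"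
  proof (rule fset.map_cong0)
    fix e
    assume "e |\<in>| C"
    then show "map_prod id (graft s) e = id e"
      using Node by (cases e) (force simp: points_Node_eq_0 simp del: points.simps)
  qed
  then show ?case
    using Node.prems by simp
qed

lemma graft_below:
  assumes "\<forall>b d. (b, d) |\<in>| C \<longrightarrow> points d = 0"
  shows "graft s (Node False (finsert (a, c) C)) = Node False (finsert (a, graft s c) C)"
proof -
  have "points (Node False C) = 0"
    using assms unfolding points_Node_eq_0 by blast
  from graft_unpointed[OF this, of s] show ?thesis
    by simp
qed

lemma points_funion_children:
  assumes "points s = 1" "\<forall>b d. (b, d) |\<in>| C \<longrightarrow> points d = 0"
  shows "points (Node (at_root s) (C |\<union>| children s)) = 1"
  using assms(1)
proof (induction s rule: pointed_induct)
  case (root D)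
  then have "points (Node True (C |\<union>| D)) = 1"
    using assms(2) unfolding points_Node_True by blast
  then show ?case
    by simp
next
  case (below a c D)
  then have "points (Node False (finsert (a, c) (C |\<union>| D))) = 1"
    using assms(2) by (intro points_Node_finsert) auto
  then show ?case
    by simp
qed

lemma points_graft: "points t = 1 \<Longrightarrow> points s = 1 \<Longrightarrow> points (graft s t) = 1"
proof (induction t rule: pointed_induct)
  case (root C)
  then show ?case
    by (simp only: graft.simps if_True points_funion_children)
next
  case (below a c C)
  then show ?case
    by (simp only: graft_below points_Node_finsert)
qed

text \<open>The vertex \<open>z\<close> is the image of the vertex where the point of
  \<open>t\<close> and the root of \<open>s\<close> are glued. The branches off the path to the
  point carry no mark, so it does not matter whether their target is \<open>y\<close> or
  \<open>z\<close>.\<close>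

lemma sat_graft:
  assumes "points t = 1"
  shows "sat E (graft s t) x y \<longleftrightarrow> (\<exists>z. sat E t x z \<and> sat E s z y)"
  using assms
proof (induction t arbitrary: x rule: pointed_induct)
  case (root C)
  have "sat E c z y \<longleftrightarrow> sat E c z x" if "(a, c) |\<in>| C" for a c z
    using root that by (metis sat_unpointed)
  then show ?case
    by (cases s) (auto simp: sat_Node)
next
  case (below a c C)
  have "points (Node False C) = 0"
    using below.hyps(2) unfolding points_Node_eq_0 by blast
  then have "sat E (Node False C) x w \<longleftrightarrow> sat E (Node False C) x y" for w
    by (rule sat_unpointed)
  then show ?case
    unfolding graft_below[OF below.hyps(2)] sat_below below.IH by blast
qed

lemma unpoint_unpointed: "points t = 0 \<Longrightarrow> unpoint t = t"
proof (induction t rule: ptree_induct)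
  case (Node p C)
  have "map_prod id unpoint |`| C = id |`| C"
  proof (rule fset.map_cong0)
    fix e
    assume "e |\<in>| C"
    then show "map_prod id unpoint e = id e"
      using Node by (cases e) (force simp: points_Node_eq_0 simp del: points.simps)
  qed
  then show ?case
    using Node.prems by simp
qed

lemma points_unpoint: "points (unpoint t) = 0"
proof (induction t rule: ptree_induct)
  case (Node p C)
  then show ?case
    by (force simp: points_Node_eq_0 simp del: points.simps)
qed

lemma unpoint_Node:
  assumes "\<forall>b d. (b, d) |\<in>| C \<longrightarrow> points d = 0"
  shows "unpoint (Node p C) = Node False C"
  using unpoint_unpointed[of "Node False C"] assms
  by (simp add: points_Node_eq_0 del: points.simps)

lemma unpoint_below:
  assumes "\<forall>b d. (b, d) |\<in>| C \<longrightarrow> points d = 0"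
  shows "unpoint (Node p (finsert (a, c) C)) = Node False (finsert (a, unpoint c) C)"
  using unpoint_Node[OF assms] by simp

text \<open>Once the mark is gone, the former point may be sent anywhere, hence the quantifier. It
  concerns only the child containing the mark, as the siblings do not depend on the target.\<close>

lemma sat_unpoint:
  assumes "points t = 1"
  shows "sat E (unpoint t) x y \<longleftrightarrow> (\<exists>z. sat E t x z)"
  using assms
proof (induction t arbitrary: x rule: pointed_induct)
  case (root C)
  have "sat E c z y \<longleftrightarrow> sat E c z x" if "(a, c) |\<in>| C" for a c z
    using root that by (metis sat_unpointed)
  then show ?case
    unfolding unpoint_Node[OF root] by (auto simp: sat_Node)
next
  case (below a c C)
  have "points (Node False C) = 0"
    using below.hyps(2) unfolding points_Node_eq_0 by blast
  then have "sat E (Node False C) x w \<longleftrightarrow> sat E (Node False C) x y" for w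
    by (rule sat_unpointed)
  then show ?case
    unfolding unpoint_below[OF below.hyps(2)] sat_below below.IH by blast
qed

lemma sat_mark_root:
  "sat E (Node True (children t)) x y \<longleftrightarrow> x = y \<and> sat E t x y"
  by (cases t) (metis ptree.sel(2) sat_Node)

lemma points_mark_root: "points t = 0 \<Longrightarrow> points (Node True (children t)) = 1"
  by (cases t) simp

lemma points_tree_concat: "points t = 1 \<Longrightarrow> points s = 1 \<Longrightarrow> points (tree_concat t s) = 1"
  unfolding tree_concat_def by (intro points_reduce_1 points_graft)

lemma points_tree_dom: "points (tree_dom t) = 1"
  unfolding tree_dom_def by (intro points_reduce_1 points_mark_root points_unpoint)

lemma sat_tree_concat:
  "points t = 1 \<Longrightarrow> sat E (tree_concat t s) x y \<longleftrightarrow> (\<exists>z. sat E t x z \<and> sat E s z y)"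
  by (simp only: tree_concat_def sat_reduce sat_graft)

lemma sat_tree_dom:
  "points t = 1 \<Longrightarrow> sat E (tree_dom t) x y \<longleftrightarrow> x = y \<and> (\<exists>z. sat E t x z)"
  by (simp only: tree_dom_def sat_reduce sat_mark_root points_unpoint sat_unpoint)

lemma sat_one_tree: "sat E one_tree x y \<longleftrightarrow> x = y"
  by (simp add: one_tree_def sat_Node)

lemma sat_edge_tree: "sat E (edge_tree a) x y \<longleftrightarrow> (x, y) \<in> E a"
  by (auto simp: edge_tree_def one_tree_def sat_Node)

section \<open>The canonical graph\<close>

definition child_rel :: "'a \<Rightarrow> 'a ptree rel" where
  "child_rel a = {(t, c). (a, c) |\<in>| children t}"

text \<open>The edges leaving a tree lead exactly to its children, so the recursive clauses of
  \<open>sat\<close> and \<open>\<preceq>\<close> agree; the first hypothesis makes being marked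
  coincide with being the target \<open>y\<close>.\<close>

lemma sat_child_rel_Node:
  assumes "p \<longleftrightarrow> Node p C = y"
    and "\<And>a c s. (a, c) |\<in>| C \<Longrightarrow> sat child_rel s c y \<longleftrightarrow> c \<preceq> s"
  shows "sat child_rel s (Node p C) y \<longleftrightarrow> Node p C \<preceq> s"
proof (cases s)
  case s: (Node q D)
  have "(Node p C, z) \<in> child_rel a \<and> sat child_rel d z y \<longleftrightarrow> (a, z) |\<in>| C \<and> z \<preceq> d" for a d z
    using assms(2) by (auto simp: child_rel_def)
  then show ?thesis
    using assms(1) unfolding s sat_Node tree_le_Node by presburger
qed

text \<open>The root of \<open>y\<close> is marked, so \<open>y\<close> is not a subtree of the
  unmarked \<open>t\<close>: no vertex of \<open>t\<close> is marked and none is the target.\<close>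

lemma sat_child_rel_unpointed:
  "points t = 0 \<Longrightarrow> at_root y \<Longrightarrow> sat child_rel s t y \<longleftrightarrow> t \<preceq> s"
proof (induction t arbitrary: s rule: ptree_induct)
  case (Node p C)
  then have "\<not> p" "\<And>a c. (a, c) |\<in>| C \<Longrightarrow> points c = 0"
    unfolding points_Node_eq_0 by auto
  with Node show ?case
    by (intro sat_child_rel_Node) auto
qed

text \<open>
  The witness is the subtree at the point of \<open>t\<close>: it occurs only once in \<open>t\<close>, since it is
  the only subtree whose root is marked.
\<close>

lemma sat_child_rel_pointed:
  assumes "points t = 1"
  shows "\<exists>y. at_root y \<and> (\<forall>s. sat child_rel s t y \<longleftrightarrow> t \<preceq> s)"
  using assms
proof (induction t rule: pointed_induct)
  case (root C)
  have C: "sat child_rel s c (Node True C) \<longleftrightarrow> c \<preceq> s" if "(a, c) |\<in>| C" for a c s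
    using root that by (intro sat_child_rel_unpointed) auto
  have "sat child_rel s (Node True C) (Node True C) \<longleftrightarrow> Node True C \<preceq> s" for s
    using C by (intro sat_child_rel_Node) auto
  then show ?case
    by (intro exI[of _ "Node True C"]) simp
next
  case (below a c C)
  then obtain y where y: "at_root y" "\<And>s. sat child_rel s c y \<longleftrightarrow> c \<preceq> s"
    by blast
  have C: "sat child_rel s d y \<longleftrightarrow> d \<preceq> s" if "(b, d) |\<in>| finsert (a, c) C" for b d s
  proof (cases "(b, d) = (a, c)")
    case True
    then show ?thesis
      using y by simp
  next
    case False
    then show ?thesis
      using y(1) that below.hyps by (intro sat_child_rel_unpointed) auto
  qed
  have ne: "Node False (finsert (a, c) C) \<noteq> y"
    using y(1) by auto
  have "sat child_rel s (Node False (finsert (a, c) C)) y \<longleftrightarrow> Node False (finsert (a, c) C) \<preceq> s" for s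
    using ne C by (intro sat_child_rel_Node) auto
  then show ?case
    using y(1) by blast
qed

lemma tree_le_iff_sat_child_rel:
  assumes "points t = 1"
  shows "t \<preceq> s \<longleftrightarrow> (\<forall>x y. sat child_rel t x y \<longrightarrow> sat child_rel s x y)"
proof
  assume "t \<preceq> s"
  then show "\<forall>x y. sat child_rel t x y \<longrightarrow> sat child_rel s x y"
    by (simp add: sat_mono)
next
  assume imp: "\<forall>x y. sat child_rel t x y \<longrightarrow> sat child_rel s x y"
  obtain y where y: "\<And>s. sat child_rel s t y \<longleftrightarrow> t \<preceq> s"
    using sat_child_rel_pointed[OF assms] by blast
  \<comment> \<open>This is the canonical homomorphism, sending each vertex of \<open>t\<close> to
    its subtree.\<close>
  have "sat child_rel t t y"
    by (simp add: y tree_le_refl)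
  then show "t \<preceq> s"
    using imp y by blast
qed

text \<open>This turns equations between reduced trees into equations between relations, where the
  operations are easy to compute.\<close>

lemma reduce_eq_iff_sat:
  assumes "points t = 1" "points s = 1"
  shows "reduce t = reduce s \<longleftrightarrow> sat child_rel t = sat child_rel s"
proof
  assume "reduce t = reduce s"
  then show "sat child_rel t = sat child_rel s"
    by (intro ext) (metis sat_reduce)
next
  assume "sat child_rel t = sat child_rel s"
  then show "reduce t = reduce s"
    using assms by (intro reduce_eqI) (simp_all only: tree_le_iff_sat_child_rel, blast+)
qed

text \<open>Composition of denotations does not see whether the factors were reduced first.
  Generation can therefore be argued on unreduced trees, reducing only at the end.\<close>

lemma tree_concat_reduce:
  assumes "points t = 1" "points s = 1"
  shows "tree_concat (reduce t) (reduce s) = reduce (graft s t)"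
  unfolding tree_concat_def
  by (subst reduce_eq_iff_sat)
    (use assms in \<open>simp_all only: points_graft points_reduce_1 fun_eq_iff sat_graft sat_reduce simp_thms\<close>)

lemma tree_dom_reduce:
  assumes "points t = 1"
  shows "tree_dom (reduce t) = tree_dom t"
  unfolding tree_dom_def
  by (subst reduce_eq_iff_sat)
    (use assms in \<open>simp_all only: points_mark_root points_unpoint points_reduce_1 fun_eq_iff
      sat_mark_root sat_unpoint sat_reduce simp_thms\<close>)

section \<open>Closure and generation\<close>

lemma labels_Node:
  "labels (Node p C) \<subseteq> \<Sigma> \<longleftrightarrow> (\<forall>a c. (a, c) |\<in>| C \<longrightarrow> a \<in> \<Sigma> \<and> labels c \<subseteq> \<Sigma>)"
  by fastforce

lemma labels_reduce: "labels t \<subseteq> \<Sigma> \<Longrightarrow> labels (reduce t) \<subseteq> \<Sigma>"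
proof (induction t rule: ptree_induct)
  case (Node p C)
  then show ?case
    by (simp only: labels_Node reduce.simps minimal_children_iff child_image_iff) blast
qed

lemma labels_graft: "labels t \<subseteq> \<Sigma> \<Longrightarrow> labels s \<subseteq> \<Sigma> \<Longrightarrow> labels (graft s t) \<subseteq> \<Sigma>"
proof (induction t rule: ptree_induct)
  case (Node p C)
  obtain q D where s: "s = Node q D"
    by (cases s)
  show ?case
    using Node unfolding s
    by (cases p)
      (simp_all only: graft.simps if_True if_False ptree.sel labels_Node child_image_iff funion_iff, blast+)
qed

lemma labels_unpoint: "labels t \<subseteq> \<Sigma> \<Longrightarrow> labels (unpoint t) \<subseteq> \<Sigma>"
proof (induction t rule: ptree_induct)
  case (Node p C)
  then show ?case
    unfolding unpoint.simps labels_Node child_image_iff by blast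
qed

lemma labels_mark_root: "labels (Node True (children t)) = labels t"
  by (cases t) simp

lemma reduced_trees_iff:
  "t \<in> reduced_trees \<Sigma> \<longleftrightarrow> labels t \<subseteq> \<Sigma> \<and> points t = 1 \<and> reduce t = t"
  by (simp add: reduced_trees_def pointed_def reduced_def)

lemma one_tree_in: "one_tree \<in> reduced_trees \<Sigma>"
  by (simp add: reduced_trees_iff one_tree_def minimal_children_empty)

lemma edge_tree_in: "a \<in> \<Sigma> \<Longrightarrow> edge_tree a \<in> reduced_trees \<Sigma>"
  using one_tree_in[of \<Sigma>]
  by (simp add: reduced_trees_iff edge_tree_def minimal_children_singleton del: points.simps)
    (simp add: one_tree_def)

lemma tree_concat_in:
  "t \<in> reduced_trees \<Sigma> \<Longrightarrow> s \<in> reduced_trees \<Sigma> \<Longrightarrow> tree_concat t s \<in> reduced_trees \<Sigma>"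
  unfolding reduced_trees_iff
  by (intro conjI points_tree_concat)
    (simp_all add: tree_concat_def labels_graft labels_reduce reduce_reduce)

lemma tree_dom_in: "t \<in> reduced_trees \<Sigma> \<Longrightarrow> tree_dom t \<in> reduced_trees \<Sigma>"
  unfolding reduced_trees_iff
  by (intro conjI points_tree_dom)
    (simp_all only: tree_dom_def labels_unpoint labels_reduce labels_mark_root reduce_reduce)

lemma tree_algebra_sel [simp]:
  "carrier (tree_algebra \<Sigma>) = reduced_trees \<Sigma>"
  "x \<otimes>\<^bsub>tree_algebra \<Sigma>\<^esub> y = tree_concat x y"
  "\<one>\<^bsub>tree_algebra \<Sigma>\<^esub> = one_tree"
  "Dom (tree_algebra \<Sigma>) = tree_dom"
  by (simp_all add: tree_algebra_def)

lemma rel_algebra_sel [simp]: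
  "carrier (rel_algebra X R) = R"
  "x \<otimes>\<^bsub>rel_algebra X R\<^esub> y = x O y"
  "\<one>\<^bsub>rel_algebra X R\<^esub> = Id_on X"
  "Dom (rel_algebra X R) = (\<lambda>r. Id_on (Domain r))"
  by (simp_all add: rel_algebra_def)

lemma dom_closed_tree_algebra: "dom_closed (tree_algebra \<Sigma>) (reduced_trees \<Sigma>)"
  by (simp add: dom_closed_def one_tree_in tree_concat_in tree_dom_in)

section \<open>Generation by the edge trees\<close>

context
  fixes \<Sigma> :: "'a set" and S :: "'a ptree set"
  assumes S: "edge_tree ` \<Sigma> \<subseteq> S" "dom_closed (tree_algebra \<Sigma>) S"
begin

lemma reduce_graft_closed:
  assumes "points t = 1" "points s = 1" "reduce t \<in> S" "reduce s \<in> S"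
  shows "reduce (graft s t) \<in> S"
proof -
  have "tree_concat (reduce t) (reduce s) \<in> S"
    using S(2) assms(3,4) by (simp add: dom_closed_def)
  then show ?thesis
    by (simp only: tree_concat_reduce assms(1,2))
qed

text \<open>Concatenation with \<open>edge_tree a\<close> on the left puts an \<open>a\<close>-edge
  above the root of \<open>t\<close>.\<close>

lemma edge_graft_closed:
  assumes "a \<in> \<Sigma>" "points t = 1" "reduce t \<in> S"
  shows "reduce (Node False {|(a, t)|}) \<in> S"
proof -
  have e: "edge_tree a \<in> S" "points (edge_tree a) = 1" "reduce (edge_tree a) = edge_tree a"
    using S(1) assms(1) edge_tree_in[OF assms(1)] by (auto simp: reduced_trees_iff)
  then have "reduce (graft t (edge_tree a)) \<in> S"
    using assms by (intro reduce_graft_closed) auto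
  moreover have "graft t (edge_tree a) = Node False {|(a, t)|}"
    by (cases t) (simp add: edge_tree_def one_tree_def)
  ultimately show ?thesis
    by simp
qed

text \<open>An unmarked \<open>t\<close> is represented by its root-marked version, a pointed tree.
  Putting an \<open>a\<close>-edge above it and taking the domain erases this auxiliary mark and
  marks the new root.\<close>

lemma edge_dom_closed:
  assumes "a \<in> \<Sigma>" "points t = 0" "reduce (Node True (children t)) \<in> S"
  shows "reduce (Node True {|(a, t)|}) \<in> S"
proof -
  let ?t = "Node True (children t)"
  have "reduce (Node False {|(a, ?t)|}) \<in> S"
    using assms points_mark_root by (intro edge_graft_closed) auto
  moreover have "points (Node False {|(a, ?t)|}) = 1"
    using points_mark_root[OF assms(2)] by (intro points_Node_finsert) auto
  ultimately have "tree_dom (Node False {|(a, ?t)|}) \<in> S"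
    using S(2) tree_dom_reduce unfolding dom_closed_def tree_algebra_sel by metis
  moreover have "unpoint ?t = t"
    using assms(2) unpoint_unpointed[OF assms(2)] by (cases t) simp
  moreover have "tree_dom (Node False {|(a, ?t)|}) = reduce (Node True {|(a, unpoint ?t)|})"
    by (simp add: tree_dom_def del: reduce.simps)
  ultimately show ?thesis
    by (simp only:)
qed

text \<open>Concatenating two root-marked trees merges their roots, so a root-marked tree is the
  product of its single branches.\<close>

lemma reduce_marked_closed:
  assumes "\<And>a c. (a, c) |\<in>| C \<Longrightarrow> points c = 0 \<and> reduce (Node True {|(a, c)|}) \<in> S"
  shows "reduce (Node True C) \<in> S"
  using assms
proof (induction C)
  case empty
  then show ?case
    using S(2) one_tree_in[of \<Sigma>] unfolding one_tree_def
    by (simp add: reduced_trees_iff dom_closed_def one_tree_def)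
next
  case (insert e C)
  obtain a c where e: "e = (a, c)"
    by fastforce
  have "reduce (graft (Node True C) (Node True {|(a, c)|})) \<in> S"
  proof (rule reduce_graft_closed)
    show "points (Node True {|(a, c)|}) = 1" "reduce (Node True {|(a, c)|}) \<in> S"
      using insert.prems[of a c] e by auto
    show "points (Node True C) = 1"
      unfolding points_Node_True using insert.prems by blast
    show "reduce (Node True C) \<in> S"
      using insert by blast
  qed
  then show ?case
    by (simp add: e)
qed

lemma reduce_mark_root_closed:
  "points t = 0 \<Longrightarrow> labels t \<subseteq> \<Sigma> \<Longrightarrow> reduce (Node True (children t)) \<in> S"
proof (induction t rule: ptree_induct)
  case (Node p C)
  have "points c = 0 \<and> reduce (Node True {|(a, c)|}) \<in> S" if "(a, c) |\<in>| C" for a c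
  proof -
    have "points c = 0"
      using Node.prems(1) that unfolding points_Node_eq_0 by blast
    moreover have "a \<in> \<Sigma>" "labels c \<subseteq> \<Sigma>"
      using Node.prems(2)[unfolded labels_Node, rule_format, OF that] by simp_all
    ultimately show ?thesis
      by (intro conjI edge_dom_closed Node.IH[OF that])
  qed
  then show ?case
    unfolding ptree.sel by (rule reduce_marked_closed)
qed

text \<open>At each step down the path to the point the tree factors: first the side branches
  \<open>C\<close> as a root-marked tree, then the edge \<open>a\<close> followed by the subtree
  \<open>c\<close>.\<close>

lemma reduce_closed: "points t = 1 \<Longrightarrow> labels t \<subseteq> \<Sigma> \<Longrightarrow> reduce t \<in> S"
proof (induction t rule: pointed_induct)
  case (root C)
  then have "points (Node False C) = 0" "labels (Node False C) \<subseteq> \<Sigma>"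
    unfolding points_Node_eq_0 labels_Node by blast+
  from reduce_mark_root_closed[OF this] show ?case
    by simp
next
  case (below a c C)
  then have "points (Node False C) = 0" "labels (Node False C) \<subseteq> \<Sigma>" "a \<in> \<Sigma>" "labels c \<subseteq> \<Sigma>"
    unfolding points_Node_eq_0 labels_Node by blast+
  have "reduce (graft (Node False {|(a, c)|}) (Node True C)) \<in> S"
  proof (rule reduce_graft_closed)
    show "points (Node True C) = 1"
      using below.hyps(2) by (simp only: points_Node_True)
    show "points (Node False {|(a, c)|}) = 1"
      using below.hyps(1) by (intro points_Node_finsert) auto
    show "reduce (Node True C) \<in> S"
      using reduce_mark_root_closed[of "Node False C"] \<open>points (Node False C) = 0\<close>
        \<open>labels (Node False C) \<subseteq> \<Sigma>\<close> by simp
    show "reduce (Node False {|(a, c)|}) \<in> S"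
      using \<open>a \<in> \<Sigma>\<close> \<open>labels c \<subseteq> \<Sigma>\<close> below by (intro edge_graft_closed) auto
  qed
  then show ?case
    by (simp add: funion_finsert_right)
qed

lemma reduced_trees_subset_closed: "reduced_trees \<Sigma> \<subseteq> S"
proof
  fix t
  assume "t \<in> reduced_trees \<Sigma>"
  then have "reduce t \<in> S" "reduce t = t"
    unfolding reduced_trees_iff by (blast intro: reduce_closed)+
  then show "t \<in> S"
    by (simp only:)
qed

end

lemma dom_generated_tree_algebra:
  "dom_generated (tree_algebra \<Sigma>) (edge_tree ` \<Sigma>) = reduced_trees \<Sigma>"
proof
  show "dom_generated (tree_algebra \<Sigma>) (edge_tree ` \<Sigma>) \<subseteq> reduced_trees \<Sigma>"
    unfolding dom_generated_def
    by (rule Inter_lower) (simp add: dom_closed_tree_algebra edge_tree_in image_subset_iff)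
  show "reduced_trees \<Sigma> \<subseteq> dom_generated (tree_algebra \<Sigma>) (edge_tree ` \<Sigma>)"
    unfolding dom_generated_def using reduced_trees_subset_closed by blast
qed

section \<open>Representation and freeness\<close>

text \<open>The restriction to \<open>X\<close> matters because \<open>sat\<close> ranges over a
  whole type: \<open>one_tree\<close> is satisfied by all pairs \<open>(x, x)\<close>, while the
  identity of the algebra is \<open>Id_on X\<close>.\<close>

definition interp :: "'x set \<Rightarrow> ('a \<Rightarrow> 'x rel) \<Rightarrow> 'a ptree \<Rightarrow> 'x rel" where
  "interp X E t = {(x, y). x \<in> X \<and> y \<in> X \<and> sat E t x y}"

lemma interp_one_tree: "interp X E one_tree = Id_on X"
  by (auto simp: interp_def sat_one_tree)

lemma interp_edge_tree: "E a \<subseteq> X \<times> X \<Longrightarrow> interp X E (edge_tree a) = E a"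
  by (auto simp: interp_def sat_edge_tree)

text \<open>The intermediate vertex must lie in \<open>X\<close>, which is where
  \<open>sat_closed\<close> enters.\<close>

lemma interp_tree_concat:
  assumes "\<And>a. E a \<subseteq> X \<times> X" "t \<in> reduced_trees \<Sigma>"
  shows "interp X E (tree_concat t s) = interp X E t O interp X E s"
proof -
  have 1: "points t = 1"
    using assms(2) by (simp add: reduced_trees_iff)
  show ?thesis
    using sat_closed[of t E X, OF 1 assms(1)] by (auto simp: interp_def sat_tree_concat[OF 1])
qed

lemma interp_tree_dom:
  assumes "\<And>a. E a \<subseteq> X \<times> X" "t \<in> reduced_trees \<Sigma>"
  shows "interp X E (tree_dom t) = Id_on (Domain (interp X E t))"
proof -
  have 1: "points t = 1"
    using assms(2) by (simp add: reduced_trees_iff)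
  show ?thesis
    using sat_closed[of t E X, OF 1 assms(1)] by (auto simp: interp_def sat_tree_dom[OF 1])
qed

lemma inj_on_interp_child_rel: "inj_on (interp UNIV child_rel) (reduced_trees \<Sigma>)"
proof (rule inj_onI)
  fix t s :: "'a ptree"
  assume ts: "t \<in> reduced_trees \<Sigma>" "s \<in> reduced_trees \<Sigma>"
    and "interp UNIV child_rel t = interp UNIV child_rel s"
  then have "sat child_rel t = sat child_rel s"
    by (auto simp: interp_def fun_eq_iff set_eq_iff)
  then show "t = s"
    using ts reduce_eq_iff_sat unfolding reduced_trees_iff by metis
qed

lemma in_Rel_tree_algebra: "in_Rel TYPE('a ptree) (tree_algebra (\<Sigma> :: 'a set))"
proof -
  let ?h = "interp UNIV child_rel :: 'a ptree \<Rightarrow> _"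
  let ?R = "?h ` reduced_trees \<Sigma>"
  have one: "?h one_tree = Id_on UNIV"
    by (rule interp_one_tree)
  have concat: "?h (tree_concat t s) = ?h t O ?h s" if "t \<in> reduced_trees \<Sigma>" for t s
    using that by (intro interp_tree_concat) simp_all
  have dom: "?h (tree_dom t) = Id_on (Domain (?h t))" if "t \<in> reduced_trees \<Sigma>" for t
    using that by (intro interp_tree_dom) simp_all
  have "dom_closed (rel_algebra UNIV ?R) ?R"
    unfolding dom_closed_def rel_algebra_sel
  proof (intro conjI ballI)
    show "Id_on UNIV \<in> ?R"
      using one one_tree_in by (metis imageI)
    show "x O y \<in> ?R" if "x \<in> ?R" "y \<in> ?R" for x y
      using that concat tree_concat_in by (smt (verit) imageE imageI)
    show "Id_on (Domain x) \<in> ?R" if "x \<in> ?R" for x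
      using that dom tree_dom_in by (smt (verit) imageE imageI)
  qed
  moreover have "?h \<in> dom_hom (tree_algebra \<Sigma>) (rel_algebra UNIV ?R)"
    by (simp add: dom_hom_def hom_def one concat dom)
  moreover have "bij_betw ?h (reduced_trees \<Sigma>) ?R"
    by (simp add: inj_on_interp_child_rel inj_on_imp_bij_betw)
  ultimately show ?thesis
    unfolding in_Rel_def using dom_closed_tree_algebra
    by (intro conjI exI[of _ UNIV] exI[of _ ?R] exI[of _ ?h]) auto
qed

section \<open>The universal property\<close>

lemma dom_hom_eq_on_trees:
  assumes g: "g \<in> dom_hom (tree_algebra \<Sigma>) B" and h: "h \<in> dom_hom (tree_algebra \<Sigma>) B"
    and eq: "\<And>a. a \<in> \<Sigma> \<Longrightarrow> g (edge_tree a) = h (edge_tree a)"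
    and t: "t \<in> reduced_trees \<Sigma>"
  shows "g t = h t"
proof -
  \<comment> \<open>The equalizer of two homomorphisms is closed under the operations, and here it
    contains the generators.\<close>
  let ?S = "{t \<in> reduced_trees \<Sigma>. g t = h t}"
  have "edge_tree ` \<Sigma> \<subseteq> ?S"
    using eq edge_tree_in by auto
  moreover have "dom_closed (tree_algebra \<Sigma>) ?S"
    using g h by (auto simp: dom_closed_def dom_hom_def hom_def one_tree_in tree_concat_in tree_dom_in)
  ultimately show ?thesis
    using reduced_trees_subset_closed t by blast
qed

text \<open>Represent \<open>B\<close> by relations via \<open>k\<close>, read each label
  \<open>a\<close> as the relation \<open>k (f a)\<close>, and pull the denotation of each tree back
  along \<open>k\<close>.\<close>

lemma dom_hom_extension_exists:
  fixes B :: "'b dom_monoid" and f :: "'a \<Rightarrow> 'b"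
  assumes B: "in_Rel TYPE('x) B" and f: "f \<in> \<Sigma> \<rightarrow> carrier B"
  shows "\<exists>h \<in> dom_hom (tree_algebra \<Sigma>) B. \<forall>a\<in>\<Sigma>. h (edge_tree a) = f a"
proof -
  obtain X :: "'x set" and R k where R: "\<forall>r\<in>R. r \<subseteq> X \<times> X" "dom_closed (rel_algebra X R) R"
    and k: "k \<in> dom_hom B (rel_algebra X R)" "bij_betw k (carrier B) R"
    and closed: "dom_closed B (carrier B)"
    using B unfolding in_Rel_def by blast
  \<comment> \<open>Labels outside \<open>\<Sigma>\<close> get the empty relation, since
    \<open>f\<close> may leave the carrier there and every \<open>E a\<close> has to be a relation
    on \<open>X\<close>.\<close>
  define E where "E a = (if a \<in> \<Sigma> then k (f a) else {})" for a
  have kf: "k (f a) \<in> R" if "a \<in> \<Sigma>" for a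
    using that f k(2) bij_betwE by fastforce
  then have E: "E a \<subseteq> X \<times> X" for a
    using R(1) by (simp add: E_def)
  \<comment> \<open>Generation shows that every denotation belongs to \<open>R\<close>, so that it
    has a preimage under \<open>k\<close>.\<close>
  let ?S = "{t \<in> reduced_trees \<Sigma>. interp X E t \<in> R}"
  have "edge_tree ` \<Sigma> \<subseteq> ?S"
    using kf edge_tree_in[of _ \<Sigma>] interp_edge_tree[of E, OF E]
    by (simp add: image_subset_iff E_def)
  moreover have "dom_closed (tree_algebra \<Sigma>) ?S"
    using R(2) by (auto simp: dom_closed_def one_tree_in tree_concat_in tree_dom_in
        interp_one_tree interp_tree_concat[of E, OF E] interp_tree_dom[of E, OF E])
  ultimately have interp: "interp X E t \<in> R" if "t \<in> reduced_trees \<Sigma>" for t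
    using reduced_trees_subset_closed that by blast
  define h where "h t = inv_into (carrier B) k (interp X E t)" for t
  have h: "h t \<in> carrier B" "k (h t) = interp X E t" if "t \<in> reduced_trees \<Sigma>" for t
  proof -
    have "interp X E t \<in> k ` carrier B"
      using interp[OF that] k(2) by (simp add: bij_betw_def)
    then show "h t \<in> carrier B" "k (h t) = interp X E t"
      unfolding h_def by (rule inv_into_into, rule f_inv_into_f)
  qed
  \<comment> \<open>All homomorphism equations for \<open>h\<close> are verified after applying the
    injective \<open>k\<close>.\<close>
  have inj: "u = v" if "u \<in> carrier B" "v \<in> carrier B" "k u = k v" for u v
    using that k(2) by (auto simp: bij_betw_def inj_on_def)
  have k_hom: "k (u \<otimes>\<^bsub>B\<^esub> v) = k u O k v" "k (Dom B u) = Id_on (Domain (k u))"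
    if "u \<in> carrier B" "v \<in> carrier B" for u v
    using k(1) that by (auto simp: dom_hom_def hom_def)
  have k_one: "k \<one>\<^bsub>B\<^esub> = Id_on X"
    using k(1) by (simp add: dom_hom_def)
  have B_closed: "\<one>\<^bsub>B\<^esub> \<in> carrier B" "\<And>u v. u \<in> carrier B \<Longrightarrow> v \<in> carrier B \<Longrightarrow> u \<otimes>\<^bsub>B\<^esub> v \<in> carrier B"
    "\<And>u. u \<in> carrier B \<Longrightarrow> Dom B u \<in> carrier B"
    using closed by (auto simp: dom_closed_def)
  have "h (tree_concat t s) = h t \<otimes>\<^bsub>B\<^esub> h s"
    if "t \<in> reduced_trees \<Sigma>" "s \<in> reduced_trees \<Sigma>" for t s
    using that by (intro inj)
      (simp_all add: h k_hom B_closed tree_concat_in interp_tree_concat[of E, OF E])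
  moreover have "h (tree_dom t) = Dom B (h t)" if "t \<in> reduced_trees \<Sigma>" for t
    using that by (intro inj)
      (simp_all add: h k_hom(2)[of "h t" "h t"] B_closed tree_dom_in interp_tree_dom[of E, OF E])
  moreover have "h one_tree = \<one>\<^bsub>B\<^esub>"
    by (intro inj) (simp_all add: h one_tree_in interp_one_tree k_one B_closed)
  ultimately have "h \<in> dom_hom (tree_algebra \<Sigma>) B"
    using h(1) by (simp add: dom_hom_def hom_def)
  moreover have "h (edge_tree a) = f a" if "a \<in> \<Sigma>" for a
    using that f edge_tree_in[OF that]
    by (intro inj) (auto simp: h interp_edge_tree[of E, OF E] E_def)
  ultimately show ?thesis
    by blast
qed

theorem theorem4p6:
  fixes \<Sigma> :: "'a set"
  shows "in_Rel TYPE('a ptree) (tree_algebra \<Sigma>) \<and>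
    edge_tree ` \<Sigma> \<subseteq> carrier (tree_algebra \<Sigma>) \<and>
    dom_generated (tree_algebra \<Sigma>) (edge_tree ` \<Sigma>) = carrier (tree_algebra \<Sigma>) \<and>
    (\<forall>(B :: 'b dom_monoid) (f :: 'a \<Rightarrow> 'b).
       in_Rel TYPE('x) B \<and> f \<in> \<Sigma> \<rightarrow> carrier B \<longrightarrow>
       (\<exists>!h. h \<in> dom_hom (tree_algebra \<Sigma>) B \<and>
             h \<in> extensional (carrier (tree_algebra \<Sigma>)) \<and>
             (\<forall>a\<in>\<Sigma>. h (edge_tree a) = f a)))"
proof (intro conjI allI impI)
  show "in_Rel TYPE('a ptree) (tree_algebra \<Sigma>)"
    by (rule in_Rel_tree_algebra)
  show "edge_tree ` \<Sigma> \<subseteq> carrier (tree_algebra \<Sigma>)"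
    using edge_tree_in by auto
  show "dom_generated (tree_algebra \<Sigma>) (edge_tree ` \<Sigma>) = carrier (tree_algebra \<Sigma>)"
    by (simp add: dom_generated_tree_algebra)
next
  fix B :: "'b dom_monoid" and f :: "'a \<Rightarrow> 'b"
  assume "in_Rel TYPE('x) B \<and> f \<in> \<Sigma> \<rightarrow> carrier B"
  then obtain h where h: "h \<in> dom_hom (tree_algebra \<Sigma>) B" "\<forall>a\<in>\<Sigma>. h (edge_tree a) = f a"
    using dom_hom_extension_exists by blast
  \<comment> \<open>Being a homomorphism constrains values on the carrier only; fixing the values
    elsewhere makes the extension unique as a function.\<close>
  let ?h = "restrict h (reduced_trees \<Sigma>)"
  have "?h \<in> dom_hom (tree_algebra \<Sigma>) B"
    using h(1) by (auto simp: dom_hom_def hom_def one_tree_in tree_concat_in tree_dom_in)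
  then show "\<exists>!h. h \<in> dom_hom (tree_algebra \<Sigma>) B \<and>
      h \<in> extensional (carrier (tree_algebra \<Sigma>)) \<and> (\<forall>a\<in>\<Sigma>. h (edge_tree a) = f a)"
  proof (intro ex1I[of _ ?h] conjI)
    fix g
    assume g: "g \<in> dom_hom (tree_algebra \<Sigma>) B \<and>
      g \<in> extensional (carrier (tree_algebra \<Sigma>)) \<and> (\<forall>a\<in>\<Sigma>. g (edge_tree a) = f a)"
    show "g = ?h"
    proof (rule extensionalityI)
      fix t
      assume "t \<in> reduced_trees \<Sigma>"
      then show "g t = ?h t"
        using dom_hom_eq_on_trees[of g \<Sigma> B h t] g h by simp
    qed (use g in auto)
  qed (use h(2) edge_tree_in[of _ \<Sigma>] in auto)
qed

end
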